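(* Let $n$ and $m$ be integers with $3\leq m\leq \lfloor n/2\rfloor$, let $G$ be a bicyclic graph on $n$ vertices with matching number $m$, and let $D$ be any orientation of $G$. Then $$M_1(D)\leq \frac{1}{2}\left[m^2-m(1+2n)+n^2+5n+2\right],$$ with equality if and only if $D$ is isomorphic to $B^{(1)}_{n,m}$ or to $B^{(2)}_{n,m}$.
   Context: All graphs are finite and simple. A bicyclic graph is a connected graph with $|E|=|V|+1$. The matching number of a graph is the maximum number of pairwise disjoint edges. An orientation $D$ of a graph $G$ is obtained by replacing each edge $uv$ by exactly one of the arcs $uv$ (from $u$ to $v$) or $vu$. For a vertex $u$ of $D$, $d^+_u$ and $d^-_u$ denote its out-degree and in-degree. The first Zagreb index of a digraph $D=(V,A)$ is $M_1(D)=\frac{1}{2}\sum_{uv\in A}(d^+_u+d^-_v)$ (equivalently $\frac12\sum_{u\in V}[(d^+_u)^2+(d^-_u)^2]$). For $3\le m\le\lfloor n/2\rfloor$, $B_{n,m}$ is the bicyclic graph on $n$ vertices obtained from two triangles sharing exactly one common vertex $c$ (so $c$ has degree 4) by attaching $n-2m+1$ pendent edges and $m-3$ paths of length two at $c$; thus $c$ has degree $n-m+2$. The orientation $B^{(1)}_{n,m}$ of $B_{n,m}$: every edge incident with $c$ is oriented away from $c$; for each attached path $c\,a\,b$ of length two the edge $ab$ is oriented from $b$ to $a$; in each triangle $c\,x\,y$ the edge $xy$ is oriented in either direction (both choices give isomorphic digraphs). $B^{(2)}_{n,m}$ is obtained from $B^{(1)}_{n,m}$ by reversing every arc. *)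

theory Defs
  imports Complex_Main "Graph_Theory.Graph_Theory"
begin

text \<open>
  A finite simple graph is a \<open>pair_graph\<close>, in which an edge joining \<open>u\<close> and \<open>v\<close> is
  represented by the two arcs \<open>(u, v)\<close> and \<open>(v, u)\<close>; \<open>edges\<close> is its set of undirected edges.
  The name \<open>connected\<close> is also used by the topology library, hence the qualified name below.
\<close>

definition edges :: "'a pair_pre_digraph \<Rightarrow> 'a set set" where
  "edges G = {{u, v} | u v. (u, v) \<in> parcs G}"

definition bicyclic :: "'a pair_pre_digraph \<Rightarrow> bool" where
  "bicyclic G \<longleftrightarrow> pair_graph G \<and> Digraph_Component.connected (with_proj G) \<and>
     card (edges G) = card (pverts G) + 1"

definition is_matching :: "'a pair_pre_digraph \<Rightarrow> 'a set set \<Rightarrow> bool" where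
  "is_matching G M \<longleftrightarrow> M \<subseteq> edges G \<and> pairwise disjnt M"

definition matching_number :: "'a pair_pre_digraph \<Rightarrow> nat" where
  "matching_number G = Max {card M | M. is_matching G M}"

definition orientation_of :: "'a pair_pre_digraph \<Rightarrow> 'a pair_pre_digraph \<Rightarrow> bool" where
  "orientation_of D G \<longleftrightarrow> pverts D = pverts G \<and> parcs D \<subseteq> parcs G \<and>
     (\<forall>(u, v) \<in> parcs G. (u, v) \<in> parcs D \<longleftrightarrow> (v, u) \<notin> parcs D)"

definition zagreb1 :: "('a, 'b) pre_digraph \<Rightarrow> real" where
  "zagreb1 D = 1 / 2 *
     (\<Sum>e \<in> arcs D. real (out_degree D (tail D e)) + real (in_degree D (head D e)))"

definition reverse_digraph :: "'a pair_pre_digraph \<Rightarrow> 'a pair_pre_digraph" where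
  "reverse_digraph D = \<lparr> pverts = pverts D, parcs = (parcs D)\<inverse> \<rparr>"

text \<open>
  The graph \<open>B\<^bsub>n,m\<^esub>\<close>, for \<open>3 \<le> m\<close> and \<open>2 * m \<le> n\<close>, on the vertices \<open>0, \<dots>, n - 1\<close>:
  the common vertex \<open>c\<close> is \<open>0\<close>, the triangles are \<open>0 1 2\<close> and \<open>0 3 4\<close>, the attached paths of
  length two are \<open>0, 5 + 2 * i, 6 + 2 * i\<close> for \<open>i < m - 3\<close>, and the remaining \<open>n - 2 * m + 1\<close>
  vertices \<open>2 * m - 1, \<dots>, n - 1\<close> are the pendent neighbours of \<open>0\<close>.
\<close>

definition B_graph :: "nat \<Rightarrow> nat \<Rightarrow> nat pair_pre_digraph" where
  "B_graph n m = \<lparr> pverts = {..<n},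
     parcs = {(u, v). {u, v} \<in>
       {{0, 1}, {0, 2}, {1, 2}, {0, 3}, {0, 4}, {3, 4}}
       \<union> (\<Union>i<m - 3. {{0, 5 + 2 * i}, {5 + 2 * i, 6 + 2 * i}})
       \<union> (\<Union>j\<in>{2 * m - 1..<n}. {{0, j}})} \<rparr>"

definition B1 :: "nat \<Rightarrow> nat \<Rightarrow> nat pair_pre_digraph" where
  "B1 n m = \<lparr> pverts = {..<n},
     parcs = {(0, 1), (0, 2), (1, 2), (0, 3), (0, 4), (3, 4)}
       \<union> (\<Union>i<m - 3. {(0, 5 + 2 * i), (6 + 2 * i, 5 + 2 * i)})
       \<union> (\<Union>j\<in>{2 * m - 1..<n}. {(0, j)}) \<rparr>"

definition B2 :: "nat \<Rightarrow> nat \<Rightarrow> nat pair_pre_digraph" where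
  "B2 n m = reverse_digraph (B1 n m)"

lemma doubleton_in_image_iff:
  "{(u, v). {u, v} \<in> (\<lambda>(a, b). {a, b}) ` A} = A \<union> A\<inverse>"
  by (auto simp: doubleton_eq_iff image_iff intro: bexI)

lemma parcs_B_graph: "parcs (B_graph n m) = parcs (B1 n m) \<union> (parcs (B1 n m))\<inverse>"
  unfolding doubleton_in_image_iff[symmetric]
  by (simp add: B_graph_def B1_def image_Un image_UN insert_commute)

lemma orientation_of_B1:
  assumes "3 \<le> m"
  shows "orientation_of (B1 n m) (B_graph n m)"
proof -
  have shape: "v \<noteq> 0 \<and> (u = 0 \<or> (u = 1 \<and> v = 2) \<or> (u = 3 \<and> v = 4) \<or> (v \<ge> 5 \<and> odd v \<and> u = v + 1))"
    if "(u, v) \<in> parcs (B1 n m)" for u v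
    using that assms by (auto simp: B1_def)
  have anti: "(v, u) \<notin> parcs (B1 n m)" if "(u, v) \<in> parcs (B1 n m)" for u v
    using shape[OF that] shape[of v u] by auto
  then show ?thesis
    unfolding orientation_of_def parcs_B_graph
  proof (intro conjI)
    show "pverts (B1 n m) = pverts (B_graph n m)" by (simp add: B1_def B_graph_def)
  qed blast+
qed

text \<open>
  The triangle edges opposite to \<open>0\<close> may be oriented in either direction; \<open>B1\<close> fixes one choice,
  which is immaterial up to isomorphism.
\<close>

lemma digraph_iso_B1I:
  assumes "3 \<le> m" "2 * m \<le> n"
    and D: "orientation_of D (B_graph n m)"
    and centre: "\<And>v. (0, v) \<in> parcs (B_graph n m) \<Longrightarrow> (0, v) \<in> parcs D"
    and paths: "\<And>i. i < m - 3 \<Longrightarrow> (6 + 2 * i, 5 + 2 * i) \<in> parcs D"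
  shows "digraph_iso (with_proj D) (with_proj (B1 n m))"
proof -
  define p :: "nat \<times> nat" where "p = (if (1, 2) \<in> parcs D then (1, 2) else (2, 1))"
  define q :: "nat \<times> nat" where "q = (if (3, 4) \<in> parcs D then (3, 4) else (4, 3))"
  define S :: "(nat \<times> nat) set" where "S = {(0, 1), (0, 2), (0, 3), (0, 4)}
       \<union> (\<Union>i<m - 3. {(0, 5 + 2 * i), (6 + 2 * i, 5 + 2 * i)})
       \<union> (\<Union>j\<in>{2 * m - 1..<n}. {(0, j)})"
  have S: "fst e = 0 \<or> (\<exists>i<m - 3. e = (6 + 2 * i, 5 + 2 * i))" if "e \<in> S" for e
    using that by (auto simp: S_def)
  have B1S: "parcs (B1 n m) = S \<union> {(1, 2), (3, 4)}"
    by (simp add: B1_def S_def insert_commute)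
  have anti: "(u, v) \<in> parcs D \<longleftrightarrow> (v, u) \<notin> parcs D" if "(u, v) \<in> parcs (B_graph n m)" for u v
    using D that by (auto simp: orientation_of_def)
  have pq: "p = (1, 2) \<or> p = (2, 1)" "q = (3, 4) \<or> q = (4, 3)"
    by (auto simp: p_def q_def)
  have "parcs (B_graph n m) = (S \<union> {(1, 2), (3, 4)}) \<union> (S \<union> {(1, 2), (3, 4)})\<inverse>"
    unfolding parcs_B_graph B1S ..
  moreover have "{p, q} \<union> {p, q}\<inverse> = {(1, 2), (3, 4)} \<union> {(1, 2), (3, 4)}\<inverse>"
    using pq by (elim disjE) (simp_all, auto)
  ultimately have G: "parcs (B_graph n m) = (S \<union> {p, q}) \<union> (S \<union> {p, q})\<inverse>"
    unfolding converse_Un by (simp only: Un_assoc Un_left_commute)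
  have sub: "S \<union> {p, q} \<subseteq> parcs D"
  proof -
    have "(1, 2) \<in> parcs (B_graph n m)" "(3, 4) \<in> parcs (B_graph n m)"
      unfolding parcs_B_graph B1S by blast+
    then have "p \<in> parcs D" "q \<in> parcs D"
      using anti by (auto simp: p_def q_def)
    moreover have "S \<subseteq> parcs D"
    proof
      fix e assume e: "e \<in> S"
      show "e \<in> parcs D"
      proof (cases "fst e = 0")
        case True
        then have "e = (0, snd e)" by (simp add: prod_eq_iff)
        moreover have "e \<in> parcs (B_graph n m)" unfolding G using e by blast
        ultimately show ?thesis using centre by metis
      next
        case False
        then show ?thesis using S[OF e] paths by auto
      qed
    qed
    ultimately show ?thesis by auto
  qed
  have "parcs D \<subseteq> S \<union> {p, q}"
  proof
    fix e assume e: "e \<in> parcs D"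
    obtain u v where uv: "e = (u, v)" by (cases e)
    have eG: "(u, v) \<in> parcs (B_graph n m)" using e uv D by (auto simp: orientation_of_def)
    then have "(v, u) \<notin> parcs D" using e uv anti by blast
    then have "(v, u) \<notin> S \<union> {p, q}" using sub by blast
    then show "e \<in> S \<union> {p, q}" using eG unfolding G uv by blast
  qed
  with sub have arcs: "parcs D = S \<union> {p, q}" by blast
  have verts: "pverts D = {..<n}" using D by (auto simp: orientation_of_def B_graph_def)
  define f :: "nat \<Rightarrow> nat" where
    "f v = (if v = fst p then 1 else if v = snd p then 2
            else if v = fst q then 3 else if v = snd q then 4 else v)" for v
  have f0: "f 0 = 0" and fp: "f (fst p) = 1" "f (snd p) = 2" "f (fst q) = 3" "f (snd q) = 4"
    and f5: "\<And>v. 5 \<le> v \<Longrightarrow> f v = v"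
    using pq by (auto simp: f_def)
  have ff: "f (f v) = v" for v using pq by (elim disjE) (simp_all add: f_def)
  then have injf: "inj f" by (rule inj_on_inverseI)
  have imv: "f ` {..<n} = {..<n}"
  proof -
    have "f v < n" if "v < n" for v using that assms(1,2) by (auto simp: f_def)
    then show ?thesis using ff by (auto simp: image_iff) (metis lessThan_iff)
  qed
  have small: "map_prod f f ` {(0, 1), (0, 2), (0, 3), (0, 4), p, q} =
      {(0, 1), (0, 2), (1, 2), (0, 3), (0, 4), (3, 4)}"
    using pq by (elim disjE) (simp_all add: f_def, auto)
  have "map_prod f f ` parcs D = map_prod f f ` {(0, 1), (0, 2), (0, 3), (0, 4), p, q}
      \<union> (\<Union>i<m - 3. {(f 0, f (5 + 2 * i)), (f (6 + 2 * i), f (5 + 2 * i))})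
      \<union> (\<Union>j\<in>{2 * m - 1..<n}. {(f 0, f j)})"
    unfolding arcs S_def by (simp add: image_Un image_UN insert_commute)
  also have "\<dots> = parcs (B1 n m)"
  proof -
    have "(\<Union>j\<in>{2 * m - 1..<n}. {(f 0, f j)}) = (\<Union>j\<in>{2 * m - 1..<n}. {(0, j)})"
      by (rule SUP_cong) (use assms(1) in \<open>auto simp: f0 intro!: f5\<close>)
    then show ?thesis unfolding small B1_def by (simp add: f0 f5)
  qed
  finally have ima: "map_prod f f ` parcs D = parcs (B1 n m)" .
  have wf: "wf_digraph (with_proj D)"
    using assms(1,2) by unfold_locales (use pq in \<open>auto simp: verts arcs S_def\<close>)
  let ?h = "\<lparr> iso_verts = f, iso_arcs = map_prod f f, iso_head = snd, iso_tail = fst \<rparr>"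
  have "pre_digraph.digraph_isomorphism (with_proj D) ?h"
    unfolding pre_digraph.digraph_isomorphism_def
    using wf injf by (auto intro: inj_on_subset prod.inj_map simp: inj_on_def dest: injD)
  moreover have "with_proj (B1 n m) = app_iso ?h (with_proj D)"
    using ima imv by (simp add: app_iso_def with_proj_def verts) (simp add: B1_def)
  ultimately show ?thesis unfolding digraph_iso_def by blast
qed

end

theory Submission
  imports Defs
begin

text \<open>
  Twice the Zagreb index of \<open>D\<close> is \<open>2 |A|\<close> plus the number of ordered pairs of distinct arcs that
  agree in their tail or in their head. Fix a vertex \<open>c\<close> of degree \<open>s\<close>, with \<open>p\<close> out-arcs and
  \<open>q\<close> in-arcs, and let \<open>F\<close> be the set of arcs avoiding \<open>c\<close>. At most one arc of a maximum matching
  meets \<open>c\<close>, so \<open>|F| = m - 1 + t\<close> and \<open>s + t = n - m + 2\<close> with \<open>t \<ge> 0\<close>. There are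
  \<open>p(p - 1) + q(q - 1)\<close> agreeing pairs at \<open>c\<close> and at most \<open>t(t - 1) + 4t\<close> inside \<open>F\<close>. An arc
  \<open>(u, v)\<close> of \<open>F\<close> agrees with at most one arc at \<open>c\<close>, or with two if \<open>u \<rightarrow> c \<rightarrow> v\<close>; the latter
  happens at most \<open>pq\<close> times, which is exactly what the pairs at \<open>c\<close> lose against \<open>s(s - 1)\<close>.
  Hence twice the index falls short of twice the claimed bound by at least \<open>2t(s - 3)\<close>.

  If some vertex has degree at least four, equality forces \<open>t = 0\<close>; then \<open>F\<close> is a matching,
  \<open>c\<close> is a source or a sink, and the structure of \<open>D\<close> can be read off. If all degrees are at
  most three, \<open>d\<^sup>2 \<le> 4d - 3\<close> gives the strict inequality, except for six vertices, where the
  equality case is excluded separately.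
\<close>

subsection \<open>Agreeing pairs of arcs\<close>

definition agree :: "'a \<times> 'a \<Rightarrow> 'a \<times> 'a \<Rightarrow> bool" where
  "agree e g \<longleftrightarrow> e \<noteq> g \<and> (fst e = fst g \<or> snd e = snd g)"

text \<open>Counts ordered pairs, so \<open>agreeing P P\<close> sees each unordered pair twice. As
  a sum of indicators it is additive over disjoint unions in either argument.\<close>

definition agreeing :: "('a \<times> 'a) set \<Rightarrow> ('a \<times> 'a) set \<Rightarrow> nat" where
  "agreeing P Q = (\<Sum>e\<in>P. \<Sum>g\<in>Q. of_bool (agree e g))"

lemma agree_commute: "agree e g \<longleftrightarrow> agree g e"
  by (auto simp: agree_def)

lemma agreeing_commute: "agreeing P Q = agreeing Q P"
  unfolding agreeing_def using agree_commute
  by (subst sum.swap) (intro sum.cong refl arg_cong[of _ _ of_bool], blast)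

lemma agreeing_Un_left:
  "finite P \<Longrightarrow> finite P' \<Longrightarrow> P \<inter> P' = {} \<Longrightarrow>
    agreeing (P \<union> P') Q = agreeing P Q + agreeing P' Q"
  by (simp add: agreeing_def sum.union_disjoint)

lemma agreeing_Un:
  assumes "finite P" "finite Q" "P \<inter> Q = {}"
  shows "agreeing (P \<union> Q) (P \<union> Q) = agreeing P P + 2 * agreeing P Q + agreeing Q Q"
proof -
  have "agreeing (P \<union> Q) (P \<union> Q) = agreeing P (P \<union> Q) + agreeing Q (P \<union> Q)"
    using assms by (rule agreeing_Un_left)
  also have "agreeing P (P \<union> Q) = agreeing P P + agreeing Q P"
    unfolding agreeing_commute[of P "P \<union> Q"] using assms by (rule agreeing_Un_left)
  also have "agreeing Q (P \<union> Q) = agreeing P Q + agreeing Q Q"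
    unfolding agreeing_commute[of Q "P \<union> Q"] using assms by (rule agreeing_Un_left)
  finally show ?thesis by (simp add: agreeing_commute[of Q P])
qed

lemma agreeing_card:
  "finite Q \<Longrightarrow> agreeing P Q = (\<Sum>e\<in>P. card {g\<in>Q. agree e g})"
  by (simp add: agreeing_def sum.If_cases of_bool_def Int_def)

definition vertex_disjoint :: "('a \<times> 'a) set \<Rightarrow> bool" where
  "vertex_disjoint M \<longleftrightarrow>
    (\<forall>e\<in>M. \<forall>g\<in>M. e \<noteq> g \<longrightarrow> {fst e, snd e} \<inter> {fst g, snd g} = {})"

lemma vertex_disjoint_subset: "vertex_disjoint M \<Longrightarrow> N \<subseteq> M \<Longrightarrow> vertex_disjoint N"
  unfolding vertex_disjoint_def by blast

lemma agreeing_vertex_disjoint: "vertex_disjoint M \<Longrightarrow> agreeing M M = 0"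
  unfolding agreeing_def
  by (intro sum.neutral ballI) (auto simp: agree_def vertex_disjoint_def)

lemma card_le_1I: "(\<And>x y. x \<in> X \<Longrightarrow> y \<in> X \<Longrightarrow> x = y) \<Longrightarrow> card X \<le> 1"
  by (cases "finite X") (auto simp: card_le_Suc0_iff_eq)

text \<open>At most one arc of \<open>M\<close> has the tail of \<open>e\<close>, and at most one
  has its head. The arc \<open>e\<close> may lie outside \<open>M\<close>.\<close>

lemma card_agree_vertex_disjoint:
  assumes "finite M" "vertex_disjoint M"
  shows "card {g\<in>M. agree e g} \<le> 2"
proof -
  have "{g\<in>M. agree e g} \<subseteq> {g\<in>M. fst g = fst e} \<union> {g\<in>M. snd g = snd e}"
    by (auto simp: agree_def)
  then have "card {g\<in>M. agree e g} \<le> card ({g\<in>M. fst g = fst e} \<union> {g\<in>M. snd g = snd e})"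
    using assms(1) by (intro card_mono) auto
  also have "\<dots> \<le> card {g\<in>M. fst g = fst e} + card {g\<in>M. snd g = snd e}"
    by (rule card_Un_le)
  also have "\<dots> \<le> 1 + 1"
    using assms(2) by (intro add_mono card_le_1I) (fastforce simp: vertex_disjoint_def)+
  finally show ?thesis by simp
qed

text \<open>The \<open>t\<close> arcs outside \<open>M\<close> form at most t(t - 1) ordered
  agreeing pairs among themselves. Each agrees with at most two arcs of \<open>M\<close>, which is
  counted in both orders; \<open>M\<close> itself contributes nothing.\<close>

lemma agreeing_near_matching:
  assumes "finite F" "M \<subseteq> F" "vertex_disjoint M" "card F = card M + t"
  shows "agreeing F F \<le> t\<^sup>2 + 3 * t"
proof -
  have fin: "finite M" using assms finite_subset by blast
  have cL: "card (F - M) = t" using assms fin by (simp add: card_Diff_subset)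
  have "agreeing (F - M) (F - M) \<le> (\<Sum>e\<in>F - M. t - 1)"
    unfolding agreeing_card[OF finite_Diff[OF assms(1)]]
  proof (rule sum_mono)
    fix e assume e: "e \<in> F - M"
    have "card {g\<in>F - M. agree e g} \<le> card (F - M - {e})"
      using assms(1) by (intro card_mono) (auto simp: agree_def)
    then show "card {g\<in>F - M. agree e g} \<le> t - 1"
      using e cL by (simp add: card_Diff_singleton)
  qed
  then have "agreeing (F - M) (F - M) \<le> t * (t - 1)" using cL by simp
  moreover have "agreeing (F - M) M \<le> (\<Sum>e\<in>F - M. 2)"
    unfolding agreeing_card[OF fin]
    by (intro sum_mono card_agree_vertex_disjoint fin assms)
  then have "agreeing (F - M) M \<le> 2 * t" using cL by simp
  moreover have "agreeing F F = agreeing (F - M) (F - M) + 2 * agreeing (F - M) M + agreeing M M"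
    using agreeing_Un[of "F - M" M] assms fin by (simp add: Un_absorb2 Diff_disjoint Int_commute)
  moreover have "t * (t - 1) + 4 * t = t\<^sup>2 + 3 * t"
    by (cases t) (auto simp: power2_eq_square)
  ultimately show ?thesis using agreeing_vertex_disjoint[OF assms(3)] by linarith
qed

section \<open>Degree sums in terms of agreeing pairs\<close>

definition outdeg :: "('a \<times> 'a) set \<Rightarrow> 'a \<Rightarrow> nat" where
  "outdeg A v = card {e\<in>A. fst e = v}"

definition indeg :: "('a \<times> 'a) set \<Rightarrow> 'a \<Rightarrow> nat" where
  "indeg A v = card {e\<in>A. snd e = v}"

text \<open>Twice the first Zagreb index, kept in the natural numbers.\<close>

definition zsum :: "('a \<times> 'a) set \<Rightarrow> nat" where
  "zsum A = (\<Sum>e\<in>A. outdeg A (fst e) + indeg A (snd e))"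

text \<open>The arcs with the tail of \<open>e\<close> and those with its head intersect in
  \<open>e\<close> alone, and their union is \<open>e\<close> with its agreeing partners. So
  \<open>e\<close> contributes 2 plus the number of its partners.\<close>

lemma zsum_eq_agreeing:
  assumes "finite A"
  shows "zsum A = 2 * card A + agreeing A A"
proof -
  have "outdeg A (fst e) + indeg A (snd e) = 2 + card {g\<in>A. agree e g}" if "e \<in> A" for e
  proof -
    have "outdeg A (fst e) + indeg A (snd e) =
        card ({g\<in>A. fst g = fst e} \<union> {g\<in>A. snd g = snd e})
        + card ({g\<in>A. fst g = fst e} \<inter> {g\<in>A. snd g = snd e})"
      unfolding outdeg_def indeg_def using assms by (intro card_Un_Int) auto
    also have "{g\<in>A. fst g = fst e} \<union> {g\<in>A. snd g = snd e} = insert e {g\<in>A. agree e g}"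
      using that by (auto simp: agree_def)
    also have "{g\<in>A. fst g = fst e} \<inter> {g\<in>A. snd g = snd e} = {e}"
      using that by (auto simp: prod_eq_iff)
    also have "card (insert e {g\<in>A. agree e g}) = 1 + card {g\<in>A. agree e g}"
      using assms by (subst card_insert_disjoint) (auto simp: agree_def)
    finally show ?thesis by simp
  qed
  then show ?thesis
    unfolding zsum_def agreeing_card[OF assms]
    by (simp only: sum.distrib cong: sum.cong) simp
qed

lemma sum_fibres:
  fixes f :: "'b \<Rightarrow> nat"
  assumes "finite A" "finite V" "h ` A \<subseteq> V"
  shows "(\<Sum>e\<in>A. f (h e)) = (\<Sum>v\<in>V. card {e\<in>A. h e = v} * f v)"
proof -
  have "(\<Sum>e\<in>A. f (h e)) = (\<Sum>v\<in>V. \<Sum>e\<in>{e\<in>A. h e = v}. f (h e))"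
    by (rule sum.group[OF assms, symmetric])
  then show ?thesis by simp
qed

locale oriented_graph =
  fixes V :: "'a set" and A :: "('a \<times> 'a) set"
  assumes finite_V: "finite V" and arcs_sub: "A \<subseteq> V \<times> V"
    and asym: "(u, v) \<in> A \<Longrightarrow> (v, u) \<notin> A"
begin

lemma finite_A: "finite A"
  using finite_V arcs_sub finite_subset by blast

lemma no_loop: "(u, u) \<notin> A"
  using asym by blast

lemma fst_arcs: "fst ` A \<subseteq> V" and snd_arcs: "snd ` A \<subseteq> V"
  using arcs_sub by auto

lemma sum_outdeg: "(\<Sum>v\<in>V. outdeg A v) = card A"
  using sum_fibres[OF finite_A finite_V fst_arcs, of "\<lambda>_. 1"]
  by (simp add: outdeg_def)

lemma sum_indeg: "(\<Sum>v\<in>V. indeg A v) = card A"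
  using sum_fibres[OF finite_A finite_V snd_arcs, of "\<lambda>_. 1"]
  by (simp add: indeg_def)

lemma zsum_eq_sum_squares: "zsum A = (\<Sum>v\<in>V. (outdeg A v)\<^sup>2 + (indeg A v)\<^sup>2)"
  using sum_fibres[OF finite_A finite_V fst_arcs, of "outdeg A"]
    sum_fibres[OF finite_A finite_V snd_arcs, of "indeg A"]
  by (simp add: zsum_def sum.distrib outdeg_def[symmetric] indeg_def[symmetric] power2_eq_square)

section \<open>Arcs at a fixed vertex and arcs avoiding it\<close>

definition star :: "'a \<Rightarrow> ('a \<times> 'a) set" where
  "star c = {e\<in>A. fst e = c} \<union> {e\<in>A. snd e = c}"

lemma card_star: "card (star c) = outdeg A c + indeg A c"
  unfolding star_def outdeg_def indeg_def
  using finite_A no_loop by (intro card_Un_disjoint) auto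

text \<open>Out-arcs of \<open>c\<close> agree pairwise, and so do in-arcs; an out-arc agreeing with
  an in-arc would be a loop. Adding \<open>card (star c)\<close> avoids the subtractions in p(p - 1)
  + q(q - 1).\<close>

lemma agreeing_star:
  "agreeing (star c) (star c) + card (star c) = (outdeg A c)\<^sup>2 + (indeg A c)\<^sup>2"
proof -
  let ?O = "{e\<in>A. fst e = c}" and ?I = "{e\<in>A. snd e = c}"
  have fin: "finite ?O" "finite ?I" using finite_A by auto
  have disj: "?O \<inter> ?I = {}" using no_loop by auto
  have 1: "agreeing ?O ?O + card ?O = card ?O * card ?O"
  proof -
    have "agreeing ?O ?O = (\<Sum>e\<in>?O. card ?O - 1)"
      unfolding agreeing_card[OF fin(1)]
    proof (rule sum.cong[OF refl])
      fix e assume e: "e \<in> ?O"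
      then have "{g\<in>?O. agree e g} = ?O - {e}" by (auto simp: agree_def)
      then show "card {g\<in>?O. agree e g} = card ?O - 1" using e by (simp add: card_Diff_singleton)
    qed
    then show ?thesis by (cases "card ?O") auto
  qed
  have 2: "agreeing ?I ?I + card ?I = card ?I * card ?I"
  proof -
    have "agreeing ?I ?I = (\<Sum>e\<in>?I. card ?I - 1)"
      unfolding agreeing_card[OF fin(2)]
    proof (rule sum.cong[OF refl])
      fix e assume e: "e \<in> ?I"
      then have "{g\<in>?I. agree e g} = ?I - {e}" by (auto simp: agree_def)
      then show "card {g\<in>?I. agree e g} = card ?I - 1" using e by (simp add: card_Diff_singleton)
    qed
    then show ?thesis by (cases "card ?I") auto
  qed
  have 3: "agreeing ?O ?I = 0"
    unfolding agreeing_def using no_loop by (intro sum.neutral ballI) (auto simp: agree_def)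
  show ?thesis
    using 1 2 3 agreeing_Un[OF fin disj] card_Un_disjoint[OF fin disj]
    by (simp add: star_def outdeg_def indeg_def power2_eq_square)
qed

text \<open>The arcs avoiding \<open>c\<close> that agree with at least one arc at
  \<open>c\<close>.\<close>

definition touching :: "'a \<Rightarrow> ('a \<times> 'a) set" where
  "touching c = {e\<in>A - star c. (fst e, c) \<in> A \<or> (c, snd e) \<in> A}"

text \<open>The arcs avoiding \<open>c\<close> that agree with two arcs at \<open>c\<close>, being
  shortcuts of a directed path through \<open>c\<close>.\<close>

definition bridging :: "'a \<Rightarrow> ('a \<times> 'a) set" where
  "bridging c = {e\<in>A - star c. (fst e, c) \<in> A \<and> (c, snd e) \<in> A}"

lemma agreeing_star_rest:
  "agreeing (star c) (A - star c) = card (touching c) + card (bridging c)"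
proof -
  have "agreeing (star c) (A - star c) = agreeing (A - star c) (star c)"
    by (rule agreeing_commute)
  also have "\<dots> = (\<Sum>e\<in>A - star c. card {g\<in>star c. agree e g})"
    using finite_A by (intro agreeing_card) (simp add: star_def)
  also have "\<dots> = (\<Sum>e\<in>A - star c. of_bool ((fst e, c) \<in> A \<or> (c, snd e) \<in> A)
      + of_bool ((fst e, c) \<in> A \<and> (c, snd e) \<in> A))"
  proof (rule sum.cong[OF refl])
    fix e assume e: "e \<in> A - star c"
    \<comment> \<open>Since \<open>e\<close> avoids \<open>c\<close>, an arc at \<open>c\<close>
      with the tail of \<open>e\<close> enters \<open>c\<close>, and one with the head of
      \<open>e\<close> leaves \<open>c\<close>.\<close>
    have "{g\<in>star c. agree e g} = {(fst e, c), (c, snd e)} \<inter> A"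
      using e by (auto simp: star_def agree_def prod_eq_iff)
    moreover have "(fst e, c) \<noteq> (c, snd e)" using e by (auto simp: star_def)
    ultimately show "card {g\<in>star c. agree e g} = of_bool ((fst e, c) \<in> A \<or> (c, snd e) \<in> A)
      + of_bool ((fst e, c) \<in> A \<and> (c, snd e) \<in> A)"
      by auto
  qed
  also have "\<dots> = card (touching c) + card (bridging c)"
    using finite_A by (simp add: sum.distrib touching_def bridging_def of_bool_def sum.If_cases Int_def)
  finally show ?thesis .
qed

lemma touching_sub: "touching c \<subseteq> A - star c"
  by (auto simp: touching_def)

text \<open>Arcs are pairs, so a bridging arc is itself a pair of an in-neighbour and an
  out-neighbour of \<open>c\<close>.\<close>

lemma bridging_sub_Times:
  "bridging c \<subseteq> fst ` {e\<in>A. snd e = c} \<times> snd ` {e\<in>A. fst e = c}"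
  by (force simp: bridging_def)

lemma card_in_out_Times:
  "card (fst ` {e\<in>A. snd e = c} \<times> snd ` {e\<in>A. fst e = c}) = indeg A c * outdeg A c"
  unfolding indeg_def outdeg_def card_cartesian_product
  by (intro arg_cong2[of _ _ _ _ "(*)"] card_image) (auto simp: inj_on_def prod_eq_iff)

lemma finite_in_out_Times:
  "finite (fst ` {e\<in>A. snd e = c} \<times> snd ` {e\<in>A. fst e = c})"
  using finite_A by simp

lemma card_bridging_le: "card (bridging c) \<le> indeg A c * outdeg A c"
  unfolding card_in_out_Times[symmetric]
  by (rule card_mono[OF finite_in_out_Times bridging_sub_Times])

text \<open>Splits the agreeing pairs according to whether their arcs meet \<open>c\<close>. It is
  an exact identity, so the equality case can be read from it.\<close>

lemma zsum_at_vertex: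
  "zsum A = outdeg A c + indeg A c + (outdeg A c)\<^sup>2 + (indeg A c)\<^sup>2 + 2 * card (A - star c)
     + 2 * card (touching c) + 2 * card (bridging c) + agreeing (A - star c) (A - star c)"
proof -
  have sub: "star c \<subseteq> A" by (auto simp: star_def)
  then have A: "A = star c \<union> (A - star c)" by blast
  have fin: "finite (star c)" "finite (A - star c)" using finite_A sub finite_subset by auto
  have "agreeing A A = agreeing (star c) (star c) + 2 * agreeing (star c) (A - star c)
     + agreeing (A - star c) (A - star c)"
    using agreeing_Un[OF fin Diff_disjoint] A by simp
  moreover have "card A = card (star c) + card (A - star c)"
    using card_Un_disjoint[OF fin Diff_disjoint] A by simp
  ultimately show ?thesis
    using zsum_eq_agreeing[OF finite_A] agreeing_star[of c] agreeing_star_rest[of c] card_star[of c]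
    by simp
qed

end

subsection \<open>The upper bound\<close>

text \<open>Twice the claimed bound, written through the degree n - m + 2 of the extremal centre and
  the m - 1 arcs that avoid it.\<close>

definition zbound :: "nat \<Rightarrow> nat \<Rightarrow> nat" where
  "zbound n m = (n - m + 2)\<^sup>2 + (n - m + 2) + 4 * (m - 1)"

text \<open>Describes \<open>B1\<close> without naming vertices. Without loops, no arc can end at
  \<open>c\<close>; sinks are handled by reversing \<open>A\<close>.\<close>

definition dominating_source :: "('a \<times> 'a) set \<Rightarrow> nat \<Rightarrow> 'a \<Rightarrow> bool" where
  "dominating_source A d c \<longleftrightarrow> outdeg A c = d \<and> (\<forall>e\<in>A. (c, snd e) \<in> A)"

section \<open>Reversing all arcs\<close>

lemma indeg_converse: "indeg (A\<inverse>) v = outdeg A v"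
proof -
  have "{e\<in>A\<inverse>. snd e = v} = prod.swap ` {e\<in>A. fst e = v}" by force
  then show ?thesis unfolding indeg_def outdeg_def by (simp add: card_image)
qed

lemma outdeg_converse: "outdeg (A\<inverse>) v = indeg A v"
  using indeg_converse[of "A\<inverse>"] by simp

lemma zsum_converse: "zsum (A\<inverse>) = zsum A"
proof -
  have "A\<inverse> = prod.swap ` A" by force
  then have "zsum (A\<inverse>) = (\<Sum>e\<in>prod.swap ` A. indeg A (fst e) + outdeg A (snd e))"
    unfolding zsum_def outdeg_converse indeg_converse by (rule sum.cong) (rule refl)
  also have "\<dots> = (\<Sum>e\<in>A. indeg A (snd e) + outdeg A (fst e))"
    by (subst sum.reindex) (rule inj_swap, simp add: comp_def)
  also have "\<dots> = zsum A"
    unfolding zsum_def by (rule sum.cong[OF refl]) (rule add.commute)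
  finally show ?thesis .
qed

lemma vertex_disjointD:
  "vertex_disjoint M \<Longrightarrow> e \<in> M \<Longrightarrow> g \<in> M \<Longrightarrow> {fst e, snd e} \<inter> {fst g, snd g} \<noteq> {} \<Longrightarrow> e = g"
  unfolding vertex_disjoint_def by metis

lemma vertex_disjoint_converse: "vertex_disjoint (M\<inverse>) \<longleftrightarrow> vertex_disjoint M"
proof -
  have *: "vertex_disjoint (M\<inverse>)" if "vertex_disjoint M" for M :: "('a \<times> 'a) set"
    unfolding vertex_disjoint_def
  proof (intro ballI impI)
    fix e g assume "e \<in> M\<inverse>" "g \<in> M\<inverse>" "e \<noteq> g"
    then have "prod.swap e \<in> M" "prod.swap g \<in> M" "prod.swap e \<noteq> prod.swap g"
      by (auto simp: prod_eq_iff)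
    then have "{fst (prod.swap e), snd (prod.swap e)} \<inter> {fst (prod.swap g), snd (prod.swap g)} = {}"
      using vertex_disjointD[OF that] by meson
    then show "{fst e, snd e} \<inter> {fst g, snd g} = {}" by auto
  qed
  show ?thesis using *[of M] *[of "M\<inverse>"] converse_converse[of M] by metis
qed

text \<open>Two pairs with a common first or second entry share a vertex, so both nonempty factors
  are singletons.\<close>

lemma vertex_disjoint_Times:
  assumes "vertex_disjoint (X \<times> Y)" "X \<noteq> {}" "Y \<noteq> {}"
  shows "card X + card Y \<le> 2"
proof -
  obtain x y where xy: "x \<in> X" "y \<in> Y" using assms by auto
  have "x' = x" if "x' \<in> X" for x'
    using vertex_disjointD[OF assms(1), of "(x', y)" "(x, y)"] that xy by simp
  then have "X = {x}" using xy by blast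
  moreover have "y' = y" if "y' \<in> Y" for y'
    using vertex_disjointD[OF assms(1), of "(x, y')" "(x, y)"] that xy by simp
  then have "Y = {y}" using xy by blast
  ultimately show ?thesis by simp
qed

text \<open>With d = p + q this is p^2 + q^2 \<le> d^2 \<le> 4d - 3, the latter being (d - 1)(d - 3)
  \<le> 0. Equality needs pq = 0 and d = 1 or d = 3.\<close>

lemma subcubic_square_bound:
  fixes p q :: nat
  assumes "1 \<le> p + q" "p + q \<le> 3"
  shows "p\<^sup>2 + q\<^sup>2 + 3 \<le> 4 * (p + q)"
    and "p\<^sup>2 + q\<^sup>2 + 3 = 4 * (p + q) \<Longrightarrow> (p, q) \<in> {(1, 0), (3, 0), (0, 1), (0, 3)}"
proof -
  have "p = 0 \<or> p = 1 \<or> p = 2 \<or> p = 3" "q = 0 \<or> q = 1 \<or> q = 2 \<or> q = 3"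
    using assms by linarith+
  then show "p\<^sup>2 + q\<^sup>2 + 3 \<le> 4 * (p + q)"
    "p\<^sup>2 + q\<^sup>2 + 3 = 4 * (p + q) \<Longrightarrow> (p, q) \<in> {(1, 0), (3, 0), (0, 1), (0, 3)}"
    using assms by (elim disjE; simp)+
qed

text \<open>The data on which the counting rests; connectedness of the graph enters through
  \<open>no_isolated\<close>.\<close>

locale matched_bicyclic = oriented_graph +
  fixes M :: "('a \<times> 'a) set" and n m :: nat
  assumes card_V: "card V = n" and card_A: "card A = n + 1"
    and M_sub: "M \<subseteq> A" and M_disj: "vertex_disjoint M" and card_M: "card M = m"
    and m_ge: "3 \<le> m" and n_ge: "2 * m \<le> n"
    and no_isolated: "v \<in> V \<Longrightarrow> 1 \<le> outdeg A v + indeg A v"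
begin

text \<open>Lets every result about sources be used for sinks.\<close>

lemma matched_bicyclic_converse: "matched_bicyclic V (A\<inverse>) (M\<inverse>) n m"
proof
  show "card (A\<inverse>) = n + 1" using card_A by simp
  show "card (M\<inverse>) = m" using card_M by simp
  show "1 \<le> outdeg (A\<inverse>) v + indeg (A\<inverse>) v" if "v \<in> V" for v
    using no_isolated[OF that] by (simp add: outdeg_converse indeg_converse add.commute)
  show "(v, u) \<notin> A\<inverse>" if "(u, v) \<in> A\<inverse>" for u v
    using asym that by blast
  show "vertex_disjoint (M\<inverse>)" using M_disj by (simp add: vertex_disjoint_converse)
qed (use finite_V arcs_sub card_V M_sub m_ge n_ge in auto)

section \<open>The estimate at a vertex and its equality case\<close>

lemma card_rest: "outdeg A c + indeg A c + card (A - star c) = n + 1"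
proof -
  have "star c \<subseteq> A" by (auto simp: star_def)
  then show ?thesis
    using card_star[of c] card_A finite_A card_mono[of A "star c"]
    by (simp add: card_Diff_subset finite_subset)
qed

text \<open>Two arcs of \<open>M\<close> at \<open>c\<close> would share \<open>c\<close>, so
  deleting the arcs at \<open>c\<close> costs \<open>M\<close> at most one arc.\<close>

lemma rest_matching:
  obtains M' where "M' \<subseteq> A - star c" "vertex_disjoint M'" "card M' = m - 1"
proof -
  have fin: "finite M" using finite_A M_sub finite_subset by blast
  have "card (M \<inter> star c) \<le> 1"
  proof (rule card_le_1I, rule ccontr)
    fix e g assume eg: "e \<in> M \<inter> star c" "g \<in> M \<inter> star c" "e \<noteq> g"
    then have "{fst e, snd e} \<inter> {fst g, snd g} = {}"
      using vertex_disjointD[OF M_disj] by (meson IntD1)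
    then show False using eg by (auto simp: star_def)
  qed
  then have "m - 1 \<le> card (M - star c)"
    using card_Diff_subset_Int[of M "star c"] fin card_M by simp
  then obtain M' where "M' \<subseteq> M - star c" "card M' = m - 1"
    using obtain_subset_with_card_n by metis
  then show thesis
    using that M_sub M_disj vertex_disjoint_subset[of M M'] by blast
qed

text \<open>The excess \<open>t\<close> of the arcs avoiding \<open>c\<close> over a matching of
  size m - 1 is also the amount by which the degree of \<open>c\<close> falls short of n - m + 2, as
  there are n + 1 arcs in all. If \<open>t = 0\<close>, these arcs are the matching itself.\<close>

lemma obtain_excess:
  obtains t where "card (A - star c) = m - 1 + t" "outdeg A c + indeg A c + t = n - m + 2"
    "agreeing (A - star c) (A - star c) \<le> t\<^sup>2 + 3 * t"
    "t = 0 \<Longrightarrow> vertex_disjoint (A - star c)"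
proof -
  obtain M' where M': "M' \<subseteq> A - star c" "vertex_disjoint M'" "card M' = m - 1"
    by (rule rest_matching)
  have fin: "finite (A - star c)" using finite_A by simp
  obtain t where t: "card (A - star c) = card M' + t"
    using card_mono[OF fin M'(1)] le_Suc_ex by blast
  show thesis
  proof
    show "card (A - star c) = m - 1 + t" using t M' by simp
    then show "outdeg A c + indeg A c + t = n - m + 2" using card_rest[of c] m_ge n_ge by linarith
    show "agreeing (A - star c) (A - star c) \<le> t\<^sup>2 + 3 * t"
      by (rule agreeing_near_matching[OF fin M'(1,2) t])
    show "vertex_disjoint (A - star c)" if "t = 0"
      using card_subset_eq[OF fin M'(1)] t that M'(2) by simp
  qed
qed

text \<open>All arcs avoiding \<open>c\<close> are allowed to touch, and the at most pq bridging
  arcs complete p^2 + q^2 to s^2. The term \<open>6 * t\<close> stands on the right to avoid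
  subtraction.\<close>

lemma zsum_bound_at_vertex:
  assumes s: "s = outdeg A c + indeg A c" and t: "s + t = n - m + 2"
  shows "zsum A + 2 * t * s \<le> zbound n m + 6 * t"
proof -
  obtain t' where t': "card (A - star c) = m - 1 + t'" "outdeg A c + indeg A c + t' = n - m + 2"
    "agreeing (A - star c) (A - star c) \<le> t'\<^sup>2 + 3 * t'" by (use obtain_excess[of c] in blast)
  have [simp]: "t' = t" using t t' s by simp
  have "card (touching c) \<le> card (A - star c)"
    using finite_A by (intro card_mono touching_sub) simp
  then have "zsum A \<le> s + (outdeg A c)\<^sup>2 + (indeg A c)\<^sup>2 + 4 * card (A - star c)
     + 2 * (indeg A c * outdeg A c) + (t\<^sup>2 + 3 * t)"
    using zsum_at_vertex[of c] card_bridging_le[of c] t'(3) s by simp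
  also have "\<dots> = s + s\<^sup>2 + 4 * (m - 1 + t) + (t\<^sup>2 + 3 * t)"
    using t'(1) s by (simp add: power2_eq_square algebra_simps)
  finally show ?thesis
    unfolding zbound_def t[symmetric] by (simp add: power2_eq_square algebra_simps)
qed

text \<open>Here the excess is 0 and the deficit is exactly \<open>2 * x + 2 * y\<close>:
  \<open>x\<close> counts the arcs avoiding \<open>c\<close> that do not touch, \<open>y\<close> the
  pairs of an in-neighbour and an out-neighbour that are not bridging arcs.\<close>

lemma zsum_eq_bound_iff:
  assumes "outdeg A c + indeg A c = n - m + 2"
  shows "zsum A = zbound n m \<longleftrightarrow>
    touching c = A - star c \<and> bridging c = fst ` {e\<in>A. snd e = c} \<times> snd ` {e\<in>A. fst e = c}"
proof -
  obtain t where t: "card (A - star c) = m - 1 + t" "outdeg A c + indeg A c + t = n - m + 2"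
    "agreeing (A - star c) (A - star c) \<le> t\<^sup>2 + 3 * t" by (use obtain_excess[of c] in blast)
  then have X: "agreeing (A - star c) (A - star c) = 0" "card (A - star c) = m - 1"
    using assms by auto
  have fin: "finite (A - star c)" using finite_A by simp
  let ?B = "fst ` {e\<in>A. snd e = c} \<times> snd ` {e\<in>A. fst e = c}"
  obtain x where x: "card (A - star c) = card (touching c) + x"
    using card_mono[OF fin touching_sub] le_Suc_ex by blast
  obtain y where y: "indeg A c * outdeg A c = card (bridging c) + y"
    using card_bridging_le le_Suc_ex by blast
  have "zsum A + 2 * x + 2 * y =
      (outdeg A c + indeg A c) + (outdeg A c)\<^sup>2 + (indeg A c)\<^sup>2 + 2 * (indeg A c * outdeg A c)
      + 4 * card (A - star c)"
    unfolding zsum_at_vertex[of c] X(1) y x by simp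
  also have "\<dots> = (outdeg A c + indeg A c)\<^sup>2 + (outdeg A c + indeg A c) + 4 * card (A - star c)"
    by (simp add: power2_eq_square algebra_simps)
  finally have "zsum A + 2 * x + 2 * y = zbound n m"
    unfolding assms zbound_def X(2) .
  then have "zsum A = zbound n m \<longleftrightarrow> x = 0 \<and> y = 0" by linarith
  also have "x = 0 \<longleftrightarrow> touching c = A - star c"
    using card_subset_eq[OF fin touching_sub] x by auto
  also have "y = 0 \<longleftrightarrow> bridging c = ?B"
  proof
    assume "y = 0"
    then show "bridging c = ?B"
      using y card_in_out_Times[of c]
      by (intro card_subset_eq[OF finite_in_out_Times bridging_sub_Times]) simp
  next
    assume "bridging c = ?B"
    then show "y = 0" using y card_in_out_Times[of c] by simp
  qed
  finally show ?thesis .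
qed

text \<open>No arc enters \<open>c\<close>, so there is nothing to bridge, and every arc avoiding
  \<open>c\<close> touches through its head.\<close>

lemma zsum_dominating_source:
  assumes "dominating_source A (n - m + 2) c"
  shows "zsum A = zbound n m"
proof -
  have dom: "(c, snd e) \<in> A" if "e \<in> A" for e
    using assms that by (auto simp: dominating_source_def)
  have ins: "{e\<in>A. snd e = c} = {}" using dom no_loop by fastforce
  then have "indeg A c = 0" unfolding indeg_def by (simp only: card.empty)
  then have s: "outdeg A c + indeg A c = n - m + 2"
    using assms by (simp add: dominating_source_def)
  show ?thesis unfolding zsum_eq_bound_iff[OF s] ins
    using dom ins by (auto simp: touching_def bridging_def)
qed

text \<open>Equality turns the whole product of in-neighbours and out-neighbours into arcs of a
  vertex-disjoint set, which is too small unless one factor is empty. Then \<open>c\<close> is a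
  source or a sink, and touching gives domination.\<close>

lemma dominating_source_if_eq:
  assumes s: "outdeg A c + indeg A c = n - m + 2" and eq: "zsum A = zbound n m"
  shows "dominating_source A (n - m + 2) c \<or> dominating_source (A\<inverse>) (n - m + 2) c"
proof -
  let ?I = "{e\<in>A. snd e = c}" and ?O = "{e\<in>A. fst e = c}"
  have fin: "finite ?I" "finite ?O" using finite_A by auto
  obtain t where "outdeg A c + indeg A c + t = n - m + 2"
    "t = 0 \<Longrightarrow> vertex_disjoint (A - star c)" by (use obtain_excess[of c] in blast)
  then have vd: "vertex_disjoint (A - star c)" using s by simp
  have touch: "touching c = A - star c" and br: "bridging c = fst ` ?I \<times> snd ` ?O"
    using zsum_eq_bound_iff[OF s] eq by auto
  have "vertex_disjoint (fst ` ?I \<times> snd ` ?O)"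
    unfolding br[symmetric] by (rule vertex_disjoint_subset[OF vd]) (auto simp: bridging_def)
  moreover have "card (fst ` ?I) = indeg A c" "card (snd ` ?O) = outdeg A c"
    unfolding indeg_def outdeg_def by (intro card_image; auto simp: inj_on_def prod_eq_iff)+
  \<comment> \<open>From n - m \<ge> m \<ge> 3; two nonempty factors would allow a degree of at most
    2.\<close>
  moreover have "5 \<le> outdeg A c + indeg A c" using s m_ge n_ge by simp
  ultimately have "?I = {} \<or> ?O = {}"
    using vertex_disjoint_Times[of "fst ` ?I" "snd ` ?O"] fin by fastforce
  then show ?thesis
  proof
    assume I: "?I = {}"
    then have "indeg A c = 0" unfolding indeg_def by (simp only: card.empty)
    then have "outdeg A c = n - m + 2" using s by simp
    moreover have "(c, snd e) \<in> A" if "e \<in> A" for e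
    proof (cases "e \<in> star c")
      case True
      then show ?thesis using I that by (auto simp: star_def)
    next
      case False
      then have "e \<in> touching c" using touch that by simp
      then show ?thesis using I by (auto simp: touching_def)
    qed
    ultimately show ?thesis by (simp add: dominating_source_def)
  next
    assume O: "?O = {}"
    then have "outdeg A c = 0" unfolding outdeg_def by (simp only: card.empty)
    then have "indeg A c = n - m + 2" using s by simp
    moreover have "(fst e, c) \<in> A" if "e \<in> A" for e
    proof (cases "e \<in> star c")
      case True
      then show ?thesis using O that by (auto simp: star_def)
    next
      case False
      then have "e \<in> touching c" using touch that by simp
      then show ?thesis using O by (auto simp: touching_def)
    qed
    ultimately show ?thesis by (auto simp: dominating_source_def outdeg_converse)
  qed
qed

section \<open>All degrees at most three\<close>

text \<open>
  On six vertices with seven arcs, sources and sinks of degree one or three must split as two of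
  degree three and one of degree one on either side; both large sources then reach every sink.
\<close>

lemma no_subcubic_source_sink_orientation:
  assumes deg: "\<And>v. v \<in> V \<Longrightarrow> (outdeg A v, indeg A v) \<in> {(1, 0), (3, 0), (0, 1), (0, 3)}"
    and n: "n = 6"
  shows False
proof -
  let ?a = "{v\<in>V. outdeg A v = 3}" and ?b = "{v\<in>V. outdeg A v = 1}"
  let ?a' = "{v\<in>V. indeg A v = 3}" and ?b' = "{v\<in>V. indeg A v = 1}"
  have count: "(\<Sum>v\<in>V. of_bool (Q v)) = card {v\<in>V. Q v}" for Q
    using finite_V by (simp add: of_bool_def sum.If_cases Int_def)
  have "(\<Sum>v\<in>V. outdeg A v) = (\<Sum>v\<in>V. 3 * of_bool (outdeg A v = 3) + of_bool (outdeg A v = 1))"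
    by (intro sum.cong refl, drule deg) auto
  then have 1: "3 * card ?a + card ?b = 7"
    unfolding sum.distrib sum_distrib_left[symmetric] count sum_outdeg card_A n by linarith
  have "(\<Sum>v\<in>V. indeg A v) = (\<Sum>v\<in>V. 3 * of_bool (indeg A v = 3) + of_bool (indeg A v = 1))"
    by (intro sum.cong refl, drule deg) auto
  then have 2: "3 * card ?a' + card ?b' = 7"
    unfolding sum.distrib sum_distrib_left[symmetric] count sum_indeg card_A n by linarith
  have "(\<Sum>v\<in>V. 1) = (\<Sum>v\<in>V. of_bool (outdeg A v = 3) + of_bool (outdeg A v = 1)
      + of_bool (indeg A v = 3) + (of_bool (indeg A v = 1) :: nat))"
    by (intro sum.cong refl, drule deg) auto
  then have 3: "card ?a + card ?b + card ?a' + card ?b' = 6"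
    unfolding sum.distrib count using card_V n by simp
  \<comment> \<open>Adding \<open>1\<close> and \<open>2\<close> and subtracting \<open>3\<close>
    leaves twice this sum equal to 8; each of \<open>1\<close> and \<open>2\<close> caps its
    cardinality of degree-three vertices at 2.\<close>
  have "card ?a + card ?a' = 4" "card ?a \<le> 2" "card ?a' \<le> 2" using 1 2 3 by linarith+
  then have "card ?a = 2" "card ?a' = 2" "card ?b' = 1" using 2 by linarith+
  obtain x y where "?a = {x, y}" and neq: "x \<noteq> y"
    using \<open>card ?a = 2\<close> unfolding card_2_iff by blast
  then have "x \<in> ?a" "y \<in> ?a" by blast+
  then have xy: "outdeg A x = 3" "outdeg A y = 3" by blast+
  have "card (?a' \<union> ?b') = card ?a' + card ?b'"
    using finite_V by (intro card_Un_disjoint) auto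
  then have sinks: "card (?a' \<union> ?b') = 3" using \<open>card ?a' = 2\<close> \<open>card ?b' = 1\<close> by simp
  have full: "(v, w) \<in> A" if v: "outdeg A v = 3" and w: "w \<in> ?a' \<union> ?b'" for v w
  proof -
    have img: "snd ` {e\<in>A. fst e = v} \<subseteq> ?a' \<union> ?b'"
    proof
      fix w assume "w \<in> snd ` {e\<in>A. fst e = v}"
      then have vw: "(v, w) \<in> A" by force
      then have "w \<in> V" using arcs_sub by auto
      moreover have "indeg A w \<noteq> 0" using vw finite_A by (auto simp: indeg_def)
      ultimately show "w \<in> ?a' \<union> ?b'" using deg[of w] by auto
    qed
    have "card (snd ` {e\<in>A. fst e = v}) = outdeg A v"
      unfolding outdeg_def by (intro card_image) (auto simp: inj_on_def prod_eq_iff)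
    then have "snd ` {e\<in>A. fst e = v} = ?a' \<union> ?b'"
      using v sinks finite_V by (intro card_subset_eq img) auto
    then have "w \<in> snd ` {e\<in>A. fst e = v}" using w by simp
    then show ?thesis by force
  qed
  \<comment> \<open>A sink of in-degree one, yet both \<open>x\<close> and \<open>y\<close> send an
    arc to it.\<close>
  obtain z where z: "z \<in> ?b'" using \<open>card ?b' = 1\<close> by (metis card_1_singletonE singletonI)
  have "{(x, z), (y, z)} \<subseteq> {e\<in>A. snd e = z}"
    using full[OF xy(1), of z] full[OF xy(2), of z] z by simp
  then have "card {(x, z), (y, z)} \<le> indeg A z"
    unfolding indeg_def using finite_A by (intro card_mono) auto
  then show False using z neq by simp
qed

text \<open>Summing the pointwise bound gives at most 8(n + 1) - 3n = 5n + 8. With N = n - m this is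
  below \<open>zbound n m\<close> as soon as N^2 > m + 6, which fails only for N = m = 3.\<close>

lemma zsum_subcubic:
  assumes "\<And>v. v \<in> V \<Longrightarrow> outdeg A v + indeg A v \<le> 3"
  shows "zsum A < zbound n m"
proof -
  have pt: "(outdeg A v)\<^sup>2 + (indeg A v)\<^sup>2 + 3 \<le> 4 * (outdeg A v + indeg A v)" if "v \<in> V" for v
    using subcubic_square_bound(1) assms no_isolated that by blast
  have lhs: "(\<Sum>v\<in>V. (outdeg A v)\<^sup>2 + (indeg A v)\<^sup>2 + 3) = zsum A + 3 * n"
    by (simp add: zsum_eq_sum_squares sum.distrib card_V)
  have rhs: "(\<Sum>v\<in>V. 4 * (outdeg A v + indeg A v)) = 8 * (n + 1)"
    using sum_outdeg sum_indeg card_A by (simp add: sum_distrib_left[symmetric] sum.distrib)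
  have le: "zsum A \<le> 5 * n + 8"
    using sum_mono[of V _ "\<lambda>v. 4 * (outdeg A v + indeg A v)", OF pt, unfolded lhs rhs] by simp
  obtain N where N: "n = m + N" "m \<le> N" using n_ge that[of "n - m"] by simp
  have bound: "zbound n m + m + 6 = 5 * n + 8 + N\<^sup>2"
    unfolding zbound_def using N m_ge by (simp add: power2_eq_square algebra_simps)
  show ?thesis
  proof (cases "N = 3")
    case False
    \<comment> \<open>Now N \<ge> 4 and N \<ge> m, and 4m \<ge> m + 9 since m \<ge> 3.\<close>
    then have "4 * m \<le> N * N" using N m_ge by (intro mult_mono) auto
    then show ?thesis using le bound m_ge by (simp add: power2_eq_square)
  next
    case True
    then have nm: "n = 6" "m = 3" using N m_ge by auto
    have "zsum A \<noteq> zbound n m"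
    proof
      assume "zsum A = zbound n m"
      then have eq: "(\<Sum>v\<in>V. (outdeg A v)\<^sup>2 + (indeg A v)\<^sup>2 + 3) = (\<Sum>v\<in>V. 4 * (outdeg A v + indeg A v))"
        using lhs rhs bound nm True by simp
      \<comment> \<open>Equal sums of termwise ordered terms force equality at every vertex.\<close>
      have "(outdeg A v)\<^sup>2 + (indeg A v)\<^sup>2 + 3 = 4 * (outdeg A v + indeg A v)" if "v \<in> V" for v
        using sum_mono_inv[OF eq pt that finite_V] .
      then show False
        by (intro no_subcubic_source_sink_orientation nm subcubic_square_bound(2) no_isolated assms)
    qed
    then show ?thesis using le bound nm True by simp
  qed
qed

text \<open>Degrees at most three give strictness; otherwise a vertex of degree at least four serves
  as \<open>c\<close>. Sinks attain the bound by the source case for \<open>rev\<close>.\<close>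

lemma zsum_le_zbound: "zsum A \<le> zbound n m"
  and zsum_eq_zbound_iff: "zsum A = zbound n m \<longleftrightarrow>
    (\<exists>c. dominating_source A (n - m + 2) c \<or> dominating_source (A\<inverse>) (n - m + 2) c)"
proof -
  interpret rev: matched_bicyclic V "A\<inverse>" "M\<inverse>" n m by (rule matched_bicyclic_converse)
  have "zsum A \<le> zbound n m \<and> (zsum A = zbound n m \<longrightarrow>
    (\<exists>c. dominating_source A (n - m + 2) c \<or> dominating_source (A\<inverse>) (n - m + 2) c))"
  proof (cases "\<forall>v\<in>V. outdeg A v + indeg A v \<le> 3")
    case True
    then have "zsum A < zbound n m" by (intro zsum_subcubic) blast
    then show ?thesis by simp
  next
    case False
    then obtain c where "\<not> outdeg A c + indeg A c \<le> 3" by blast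
    then have c: "4 \<le> outdeg A c + indeg A c" by simp
    obtain t where t: "outdeg A c + indeg A c + t = n - m + 2" by (use obtain_excess[of c] in blast)
    \<comment> \<open>Degree at least four outweighs the \<open>6 * t\<close> of the estimate by
      \<open>2 * t\<close>.\<close>
    have "2 * t * 4 \<le> 2 * t * (outdeg A c + indeg A c)" using c by (intro mult_left_mono) auto
    then have le: "zsum A + 2 * t \<le> zbound n m"
      using zsum_bound_at_vertex[OF refl t] by linarith
    show ?thesis
    proof (cases "t = 0")
      case True
      then have "outdeg A c + indeg A c = n - m + 2" using t by simp
      then show ?thesis using dominating_source_if_eq[of c] le by force
    next
      case False
      then show ?thesis using le by simp
    qed
  qed
  then show "zsum A \<le> zbound n m" and "zsum A = zbound n m \<longleftrightarrow>
      (\<exists>c. dominating_source A (n - m + 2) c \<or> dominating_source (A\<inverse>) (n - m + 2) c)"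
    using zsum_dominating_source rev.zsum_dominating_source[unfolded zsum_converse] by blast+
qed

end

subsection \<open>The extremal digraphs\<close>

lemma parcs_B1_subset:
  assumes "3 \<le> m" "2 * m \<le> n"
  shows "parcs (B1 n m) \<subseteq> {..<n} \<times> {..<n}"
  using assms by (auto simp: B1_def)

text \<open>The out-neighbours of 0 are 4 triangle vertices, m - 3 path middles and n - 2m + 1
  pendent vertices.\<close>

lemma dominating_source_B1:
  assumes "3 \<le> m" "2 * m \<le> n"
  shows "dominating_source (parcs (B1 n m)) (n - m + 2) 0"
proof -
  let ?N = "{1, 2, 3, 4} \<union> (\<lambda>i. 5 + 2 * i) ` {..<m - 3} \<union> {2 * m - 1..<n}"
  have "{e\<in>parcs (B1 n m). fst e = 0} = Pair 0 ` ?N"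
    by (auto simp: B1_def)
  then have "outdeg (parcs (B1 n m)) 0 = card ?N"
    unfolding outdeg_def by (simp only:) (rule card_image, simp add: inj_on_def)
  also have "\<dots> = card ({1, 2, 3, 4} \<union> (\<lambda>i. 5 + 2 * i) ` {..<m - 3}) + card {2 * m - 1..<n}"
    using assms by (intro card_Un_disjoint) auto
  also have "card ({1, 2, 3, 4} \<union> (\<lambda>i. 5 + 2 * i) ` {..<m - 3})
      = card {1, 2, 3, 4::nat} + card ((\<lambda>i. 5 + 2 * i :: nat) ` {..<m - 3})"
    by (intro card_Un_disjoint) auto
  also have "card ((\<lambda>i. 5 + 2 * i :: nat) ` {..<m - 3}) = m - 3"
    by (simp add: card_image inj_on_def)
  finally have "outdeg (parcs (B1 n m)) 0 = n - m + 2" using assms by simp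
  moreover have "(0, snd e) \<in> parcs (B1 n m)" if "e \<in> parcs (B1 n m)" for e
    using that by (auto simp: B1_def)
  ultimately show ?thesis by (auto simp: dominating_source_def)
qed

text \<open>Pulls the property back along a relabelling, so that it can be read off from
  \<open>B1\<close>.\<close>

lemma dominating_source_transfer:
  assumes inj: "inj_on f V" and sub: "A \<subseteq> V \<times> V" and c: "c \<in> V"
    and dom: "dominating_source (map_prod f f ` A) d (f c)"
  shows "dominating_source A d c"
proof -
  have injm: "inj_on (map_prod f f) A"
    using inj_on_subset[OF map_prod_inj_on[OF inj inj] sub] .
  have "{e\<in>map_prod f f ` A. fst e = f c} = map_prod f f ` {e\<in>A. fst e = c}"
    using inj sub c by (force dest: inj_onD)
  then have "outdeg (map_prod f f ` A) (f c) = outdeg A c"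
    unfolding outdeg_def using inj_on_subset[OF injm] by (simp add: card_image)
  moreover have "(c, snd e) \<in> A" if e: "e \<in> A" for e
  proof -
    have "(f c, f (snd e)) \<in> map_prod f f ` A"
      using dom e unfolding dominating_source_def by (metis image_eqI snd_map_prod)
    then obtain u v where uv: "(u, v) \<in> A" "f u = f c" "f v = f (snd e)" by auto
    moreover have "u \<in> V" "v \<in> V" "snd e \<in> V" using sub e uv(1) by auto
    ultimately show ?thesis using inj c by (metis inj_onD)
  qed
  ultimately show ?thesis using dom by (auto simp: dominating_source_def)
qed

lemma lessThan_eq_B1_blocks:
  fixes n m :: nat
  assumes "3 \<le> m" "2 * m \<le> n"
  shows "{..<n} = {0, 1, 2, 3, 4} \<union> (\<Union>i<m - 3. {5 + 2 * i, 6 + 2 * i}) \<union> {2 * m - 1..<n}"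
    (is "_ = ?R")
proof
  show "?R \<subseteq> {..<n}" using assms by auto
  show "{..<n} \<subseteq> ?R"
  proof
    fix v assume v: "v \<in> {..<n}"
    show "v \<in> ?R"
    proof (cases "5 \<le> v \<and> v < 2 * m - 1")
      case False
      then show ?thesis using v by auto
    next
      case True
      \<comment> \<open>The index of the attached path containing \<open>v\<close>; its vertices are
        \<open>5 + 2 * i\<close> and \<open>6 + 2 * i\<close>.\<close>
      define i where "i = (v - 5) div 2"
      have "v = 5 + 2 * i \<or> v = 6 + 2 * i" "i < m - 3"
        using True assms unfolding i_def by presburger+
      then show ?thesis by blast
    qed
  qed
qed

section \<open>Rebuilding the extremal digraph from a dominating source\<close>

context matched_bicyclic
begin

text \<open>The arcs \<open>F\<close> avoiding \<open>c\<close> form a matching with all heads in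
  the out-neighbourhood \<open>N\<close>. Those with tail in \<open>N\<close> close triangles
  (\<open>T\<close>), the others end attached paths (\<open>P\<close>), and \<open>R\<close>
  collects the pendent neighbours. Counting fixes the sizes, and \<open>g\<close> lists the pieces
  in the order of \<open>B1\<close>.\<close>

lemma B1_iso_if_dominating_source:
  assumes dom: "dominating_source A (n - m + 2) c"
  obtains g where "inj_on g {..<n}" "g ` {..<n} = V" "map_prod g g ` parcs (B1 n m) = A"
proof -
  define N where "N = snd ` {e\<in>A. fst e = c}"
  define F where "F = {e\<in>A. fst e \<noteq> c}"
  define T where "T = {e\<in>F. fst e \<in> N}"
  define P where "P = F - T"
  define R where "R = N - (snd ` F \<union> fst ` T)"
  have N_iff: "w \<in> N \<longleftrightarrow> (c, w) \<in> A" for w unfolding N_def by force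
  have into: "snd e \<in> N" if "e \<in> A" for e
    using dom that by (simp add: N_iff dominating_source_def)
  have c_notin: "c \<notin> N" using N_iff no_loop by simp
  have no_in: "snd e \<noteq> c" if "e \<in> A" for e using into[OF that] c_notin by auto
  have fin: "finite N" "finite F" "finite T" "finite P"
    unfolding N_def F_def T_def P_def using finite_A by auto
  have cN: "card N = n - m + 2"
    using dom unfolding N_def dominating_source_def outdeg_def
    by (subst card_image) (auto simp: inj_on_def prod_eq_iff)
  have F_eq: "F = A - star c" unfolding F_def star_def using no_in by auto
  have "{e\<in>A. snd e = c} = {}" using no_in by blast
  then have "indeg A c = 0" unfolding indeg_def by (simp only: card.empty)
  then have "outdeg A c + indeg A c = n - m + 2" using dom by (simp add: dominating_source_def)
  then have cF: "card F = m - 1" and vd: "vertex_disjoint F"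
    unfolding F_eq using obtain_excess[of c] by (metis add_cancel_right_right)+
  have inj_fst: "inj_on fst F" and inj_snd: "inj_on snd F"
    by (intro inj_onI vertex_disjointD[OF vd]; simp)+
  have A_eq: "A = Pair c ` N \<union> F"
    unfolding F_def using N_iff by (auto simp: image_iff)
  \<comment> \<open>A vertex outside \<open>N\<close> is no head; not being isolated, it is
    \<open>c\<close> or the tail of an arc in \<open>P\<close>.\<close>
  have V_eq: "V = {c} \<union> N \<union> fst ` P"
  proof
    show "{c} \<union> N \<union> fst ` P \<subseteq> V"
    proof -
      have "N \<noteq> {}" using cN by auto
      then have "c \<in> V" using N_iff arcs_sub by auto
      moreover have "N \<subseteq> V" using N_iff arcs_sub by auto
      moreover have "fst ` P \<subseteq> V" unfolding P_def F_def using arcs_sub by auto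
      ultimately show ?thesis by blast
    qed
    show "V \<subseteq> {c} \<union> N \<union> fst ` P"
    proof
      fix v assume "v \<in> V"
      then have "outdeg A v \<noteq> 0 \<or> indeg A v \<noteq> 0" using no_isolated[of v] by auto
      then have "{e\<in>A. fst e = v} \<noteq> {} \<or> {e\<in>A. snd e = v} \<noteq> {}"
        unfolding outdeg_def indeg_def by (metis card.empty)
      then obtain e where e: "e \<in> A" "fst e = v \<or> snd e = v" by blast
      show "v \<in> {c} \<union> N \<union> fst ` P"
      proof (cases "v = c \<or> v \<in> N")
        case False
        then have "fst e = v" using e into[of e] by auto
        then have "e \<in> P" using False e unfolding P_def T_def F_def by auto
        then show ?thesis using \<open>fst e = v\<close> by auto
      qed auto
    qed
  qed
  have PF: "P \<subseteq> F" "T \<subseteq> F" "P \<inter> T = {}" "F = P \<union> T" unfolding P_def T_def by auto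
  have P_out: "fst e \<notin> {c} \<union> N" if "e \<in> P" for e
    using that unfolding P_def T_def F_def by auto
  \<comment> \<open>The vertex count n = (n - m + 3) + |P| leaves exactly two arcs for
    \<open>T\<close>, that is, two triangles.\<close>
  have "n = card ({c} \<union> N) + card (fst ` P)"
    using card_V fin P_out unfolding V_eq by (subst card_Un_disjoint[symmetric]) auto
  also have "card ({c} \<union> N) = n - m + 3" using c_notin fin cN by simp
  also have "card (fst ` P) = card P" using inj_on_subset[OF inj_fst PF(1)] by (rule card_image)
  finally have cP: "card P = m - 3" using m_ge n_ge by linarith
  have cT: "card T = 2"
    using card_Un_disjoint[OF fin(4,3) PF(3)] cF cP m_ge unfolding PF(4)[symmetric] by linarith
  then obtain a b where "T = {a, b}" "a \<noteq> b" by (auto simp: card_2_iff)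
  moreover obtain x1 y1 x2 y2 where "a = (x1, y1)" "b = (x2, y2)" by (metis surj_pair)
  ultimately have T_eq: "T = {(x1, y1), (x2, y2)}" by simp
  \<comment> \<open>Vertex-disjointness would identify the two arcs and produce a loop.\<close>
  have disj: "snd ` F \<inter> fst ` T = {}"
  proof -
    have False if "e \<in> F" "g \<in> T" "snd e = fst g" for e g
    proof -
      have "e = g" using vertex_disjointD[OF vd, of e g] that PF by auto
      then have "(fst e, fst e) \<in> A" using that unfolding F_def by (cases e) auto
      then show False using no_loop by blast
    qed
    then show ?thesis by (auto simp: image_iff)
  qed
  have sub: "snd ` F \<union> fst ` T \<subseteq> N" using into unfolding T_def F_def by auto
  \<comment> \<open>The m - 1 heads and the two triangle tails leave n - 2m + 1 vertices of
    \<open>N\<close> for \<open>R\<close>.\<close>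
  have "card (snd ` F \<union> fst ` T) = card (snd ` F) + card (fst ` T)"
    using fin disj by (intro card_Un_disjoint) auto
  also have "\<dots> = m + 1"
    using card_image[OF inj_snd] card_image[OF inj_on_subset[OF inj_fst PF(2)]] cF cT m_ge by simp
  finally have cR: "card R = n - 2 * m + 1"
    unfolding R_def using card_Diff_subset[OF _ sub] fin cN n_ge by simp
  have N_eq: "N = snd ` F \<union> fst ` T \<union> R" unfolding R_def using sub by auto
  have "card {..<m - 3} = card P" using cP by simp
  then obtain h where h: "bij_betw h {..<m - 3} P"
    using finite_same_card_bij[OF finite_lessThan fin(4)] by blast
  have "finite R" unfolding R_def using fin by simp
  moreover have "card {2 * m - 1..<n} = card R" using cR m_ge n_ge by simp
  ultimately obtain p where p: "bij_betw p {2 * m - 1..<n} R"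
    using finite_same_card_bij[OF finite_atLeastLessThan] by blast
  have h_img: "h ` {..<m - 3} = P" and p_img: "p ` {2 * m - 1..<n} = R"
    using h p by (auto simp: bij_betw_def)
  \<comment> \<open>Odd path positions are the vertices adjacent to \<open>c\<close>, hence heads of
    arcs in \<open>P\<close>; even ones are their tails.\<close>
  define g where "g v = (if v = 0 then c else if v = 1 then x1 else if v = 2 then y1
    else if v = 3 then x2 else if v = 4 then y2
    else if v < 2 * m - 1 then (if odd v then snd else fst) (h ((v - 5) div 2)) else p v)" for v
  have g_small: "g 0 = c" "g (Suc 0) = x1" "g 2 = y1" "g 3 = x2" "g 4 = y2" by (simp_all add: g_def)
  have g_path: "g (5 + 2 * i) = snd (h i)" "g (6 + 2 * i) = fst (h i)" if "i < m - 3" for i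
  proof -
    have "(6 + 2 * i - 5) div 2 = i" by simp
    then show "g (5 + 2 * i) = snd (h i)" "g (6 + 2 * i) = fst (h i)"
      using that by (auto simp: g_def)
  qed
  have g_pend: "g j = p j" if "j \<in> {2 * m - 1..<n}" for j
    using that m_ge by (auto simp: g_def)
  have UN_path: "(\<Union>i<m - 3. {k (h i), l (h i)}) = k ` P \<union> l ` P" for k l :: "'a \<times> 'a \<Rightarrow> 'c"
    unfolding h_img[symmetric] by auto
  have UN_pend: "(\<Union>j\<in>{2 * m - 1..<n}. {k (p j)}) = k ` R" for k :: "'a \<Rightarrow> 'c"
    unfolding p_img[symmetric] by auto
  have "g ` {..<n} = {c, x1, y1, x2, y2} \<union> (\<Union>i<m - 3. {g (5 + 2 * i), g (6 + 2 * i)})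
      \<union> g ` {2 * m - 1..<n}"
    unfolding lessThan_eq_B1_blocks[OF m_ge n_ge] by (simp add: image_Un image_UN g_small)
  also have "(\<Union>i<m - 3. {g (5 + 2 * i), g (6 + 2 * i)}) = snd ` P \<union> fst ` P"
    unfolding UN_path[symmetric] by (intro SUP_cong refl) (simp add: g_path)
  also have "g ` {2 * m - 1..<n} = R"
    unfolding p_img[symmetric] by (intro image_cong refl g_pend)
  also have "{c, x1, y1, x2, y2} \<union> (snd ` P \<union> fst ` P) \<union> R = V"
    unfolding V_eq N_eq PF(4) by (auto simp: T_eq)
  finally have img: "g ` {..<n} = V" .
  \<comment> \<open>A surjection between finite sets of equal size is injective.\<close>
  have inj: "inj_on g {..<n}"
    using card_V img by (intro eq_card_imp_inj_on) auto
  have "map_prod g g ` parcs (B1 n m) =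
      {(c, x1), (c, y1), (x1, y1), (c, x2), (c, y2), (x2, y2)}
       \<union> (\<Union>i<m - 3. {(c, g (5 + 2 * i)), (g (6 + 2 * i), g (5 + 2 * i))})
       \<union> (\<Union>j\<in>{2 * m - 1..<n}. {(c, g j)})"
    unfolding B1_def by (simp add: image_Un image_UN g_small)
  also have "(\<Union>i<m - 3. {(c, g (5 + 2 * i)), (g (6 + 2 * i), g (5 + 2 * i))})
      = (\<lambda>e. (c, snd e)) ` P \<union> (\<lambda>e. (fst e, snd e)) ` P"
    unfolding UN_path[symmetric] by (intro SUP_cong refl) (simp add: g_path)
  also have "(\<Union>j\<in>{2 * m - 1..<n}. {(c, g j)}) = Pair c ` R"
    unfolding UN_pend[symmetric] by (intro SUP_cong refl) (simp add: g_pend)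
  also have "{(c, x1), (c, y1), (x1, y1), (c, x2), (c, y2), (x2, y2)}
      \<union> ((\<lambda>e. (c, snd e)) ` P \<union> (\<lambda>e. (fst e, snd e)) ` P) \<union> Pair c ` R = A"
    unfolding A_eq N_eq PF(4) by (auto simp: T_eq)
  finally show thesis using that inj img by blast
qed

text \<open>One direction inverts the relabelling \<open>g\<close>; in the other, the centre is the
  preimage of 0.\<close>

lemma dominating_source_iff_B1:
  "(\<exists>c. dominating_source A (n - m + 2) c) \<longleftrightarrow>
    (\<exists>f. inj_on f V \<and> f ` V = {..<n} \<and> map_prod f f ` A = parcs (B1 n m))"
proof
  assume "\<exists>c. dominating_source A (n - m + 2) c"
  then obtain g where g: "inj_on g {..<n}" "g ` {..<n} = V" "map_prod g g ` parcs (B1 n m) = A"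
    using B1_iso_if_dominating_source by metis
  let ?f = "inv_into {..<n} g"
  have "inj_on ?f V" using g(2) by (metis inj_on_inv_into order_refl)
  moreover have "?f ` V = {..<n}" using g(1,2) by (metis inv_into_image_cancel order_refl)
  moreover have "map_prod ?f ?f ` A = parcs (B1 n m)"
  proof -
    have "map_prod ?f ?f (map_prod g g e) = e" if "e \<in> parcs (B1 n m)" for e
      using that parcs_B1_subset[OF m_ge n_ge] g(1) by (cases e) auto
    then show ?thesis unfolding g(3)[symmetric] by (force simp: image_image)
  qed
  ultimately show "\<exists>f. inj_on f V \<and> f ` V = {..<n} \<and> map_prod f f ` A = parcs (B1 n m)" by blast
next
  assume "\<exists>f. inj_on f V \<and> f ` V = {..<n} \<and> map_prod f f ` A = parcs (B1 n m)"
  then obtain f where f: "inj_on f V" "f ` V = {..<n}" "map_prod f f ` A = parcs (B1 n m)" by blast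
  have "0 \<in> f ` V" unfolding f(2) using m_ge n_ge by simp
  then obtain c where c: "c \<in> V" "f c = 0" by auto
  show "\<exists>c. dominating_source A (n - m + 2) c"
    using dominating_source_transfer[OF f(1) arcs_sub c(1)] dominating_source_B1[OF m_ge n_ge] f(3) c(2)
    by metis
qed

end

subsection \<open>Orientations of bicyclic graphs\<close>

text \<open>Tail and head are \<open>fst\<close> and \<open>snd\<close> on both sides, so the arc
  map of an isomorphism is determined by its vertex map.\<close>

lemma digraph_iso_with_proj_iff:
  assumes "parcs D \<subseteq> pverts D \<times> pverts D"
  shows "digraph_iso (with_proj D) (with_proj E) \<longleftrightarrow>
    (\<exists>f. inj_on f (pverts D) \<and> f ` pverts D = pverts E \<and> map_prod f f ` parcs D = parcs E)"
proof
  assume "digraph_iso (with_proj D) (with_proj E)"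
  then obtain h where h: "pre_digraph.digraph_isomorphism (with_proj D) h"
    "with_proj E = app_iso h (with_proj D)"
    unfolding digraph_iso_def by blast
  let ?f = "iso_verts h"
  have E: "pverts E = ?f ` pverts D" "parcs E = iso_arcs h ` parcs D" "fst = iso_tail h" "snd = iso_head h"
    using h(2) by (simp_all add: with_proj_def app_iso_def)
  have "iso_arcs h e = map_prod ?f ?f e" if "e \<in> parcs D" for e
    using h(1) that E(3,4) by (simp add: pre_digraph.digraph_isomorphism_def prod_eq_iff)
  then have "map_prod ?f ?f ` parcs D = parcs E" unfolding E(2) by (intro image_cong) auto
  then show "\<exists>f. inj_on f (pverts D) \<and> f ` pverts D = pverts E \<and> map_prod f f ` parcs D = parcs E"
    using h(1) E(1) by (auto simp: pre_digraph.digraph_isomorphism_def)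
next
  assume "\<exists>f. inj_on f (pverts D) \<and> f ` pverts D = pverts E \<and> map_prod f f ` parcs D = parcs E"
  then obtain f where f: "inj_on f (pverts D)" "f ` pverts D = pverts E"
    "map_prod f f ` parcs D = parcs E" by blast
  let ?h = "\<lparr> iso_verts = f, iso_arcs = map_prod f f, iso_head = snd, iso_tail = fst \<rparr>"
  have "wf_digraph (with_proj D)" using assms by unfold_locales auto
  moreover have "inj_on (map_prod f f) (parcs D)"
    using inj_on_subset[OF map_prod_inj_on[OF f(1) f(1)] assms] .
  ultimately have "pre_digraph.digraph_isomorphism (with_proj D) ?h"
    using f(1) by (simp add: pre_digraph.digraph_isomorphism_def)
  moreover have "with_proj E = app_iso ?h (with_proj D)"
    using f(2,3) by (simp add: with_proj_def app_iso_def)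
  ultimately show "digraph_iso (with_proj D) (with_proj E)" unfolding digraph_iso_def by blast
qed

lemma zagreb1_with_proj: "zagreb1 (with_proj D) = 1 / 2 * real (zsum (parcs D))"
  by (simp add: zagreb1_def zsum_def outdeg_def indeg_def out_degree_def in_degree_def
      out_arcs_def in_arcs_def)

lemma real_zbound:
  assumes "3 \<le> m" "2 * m \<le> n"
  shows "real (zbound n m) = (real m)\<^sup>2 - real m * (1 + 2 * real n) + (real n)\<^sup>2 + 5 * real n + 2"
proof -
  obtain N where "n = m + N" using assms(2) le_Suc_ex[of m n] by auto
  then show ?thesis
    using assms(1) by (simp add: zbound_def of_nat_diff power2_eq_square algebra_simps)
qed

text \<open>A walk from \<open>v\<close> to another vertex in the symmetric closure starts with an
  arc at \<open>v\<close>.\<close>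

lemma connected_has_neighbour:
  assumes "Digraph_Component.connected (with_proj G)" "v \<in> pverts G" "2 \<le> card (pverts G)"
  obtains w where "(v, w) \<in> parcs G \<or> (w, v) \<in> parcs G"
proof -
  have "pverts G \<noteq> {v}" using assms(3) by auto
  then obtain w where w: "w \<in> pverts G" "w \<noteq> v" using assms(2) by blast
  have "v \<rightarrow>\<^sup>*\<^bsub>with_proj (mk_symmetric (with_proj G))\<^esub> w"
    using assms(1,2) w unfolding connected_def strongly_connected_def by simp
  then obtain u where "(v, u) \<in> parcs (mk_symmetric (with_proj G))"
    using w by (cases rule: pre_digraph.converse_reachable_cases) auto
  then have "(v, u) \<in> parcs G \<or> (u, v) \<in> parcs G" by (auto simp: parcs_mk_symmetric)
  then show thesis using that by blast
qed

lemma obtain_maximum_matching: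
  assumes "finite (edges G)"
  obtains M where "is_matching G M" "card M = matching_number G"
proof -
  let ?C = "{card M | M. is_matching G M}"
  have "?C \<subseteq> card ` Pow (edges G)" by (auto simp: is_matching_def)
  then have "finite ?C" using assms finite_subset by blast
  moreover have "is_matching G {}" by (simp add: is_matching_def)
  then have "?C \<noteq> {}" by blast
  ultimately have "matching_number G \<in> ?C" unfolding matching_number_def by (rule Max_in)
  then show thesis using that by auto
qed

text \<open>Of the two arcs of an edge, not both lie in \<open>D\<close>, which gives injectivity,
  and at least one does, which gives surjectivity.\<close>

lemma bij_betw_orientation_edges:
  assumes "orientation_of D G" "pair_graph G"
  shows "bij_betw (\<lambda>e. {fst e, snd e}) (parcs D) (edges G)"
proof -
  interpret pair_graph G by fact
  have sub: "parcs D \<subseteq> parcs G"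
    and anti: "\<And>u v. (u, v) \<in> parcs G \<Longrightarrow> (u, v) \<in> parcs D \<longleftrightarrow> (v, u) \<notin> parcs D"
    using assms(1) by (auto simp: orientation_of_def)
  have "inj_on (\<lambda>e. {fst e, snd e}) (parcs D)"
  proof (rule inj_onI)
    fix e g assume eg: "e \<in> parcs D" "g \<in> parcs D" "{fst e, snd e} = {fst g, snd g}"
    then have "e = g \<or> e = (snd g, fst g)" by (auto simp: doubleton_eq_iff prod_eq_iff)
    moreover have "(snd g, fst g) \<notin> parcs D" using eg(2) anti[of "fst g" "snd g"] sub by auto
    ultimately show "e = g" using eg(1) by auto
  qed
  moreover have "(\<lambda>e. {fst e, snd e}) ` parcs D = edges G"
  proof
    show "(\<lambda>e. {fst e, snd e}) ` parcs D \<subseteq> edges G"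
      using sub by (force simp: edges_def)
    show "edges G \<subseteq> (\<lambda>e. {fst e, snd e}) ` parcs D"
    proof
      fix x assume "x \<in> edges G"
      then obtain u v where uv: "x = {u, v}" "(u, v) \<in> parcs G" by (auto simp: edges_def)
      then consider "(u, v) \<in> parcs D" | "(v, u) \<in> parcs D" using anti by blast
      then show "x \<in> (\<lambda>e. {fst e, snd e}) ` parcs D"
        by cases (force simp: uv(1) insert_commute)+
    qed
  qed
  ultimately show ?thesis by (simp add: bij_betw_def)
qed

text \<open>The arc count and a maximum matching are carried from \<open>G\<close> to
  \<open>D\<close> along the bijection between arcs and edges.\<close>

lemma matched_bicyclic_orientation:
  assumes "3 \<le> m" "2 * m \<le> n" "bicyclic G" "card (pverts G) = n" "matching_number G = m"
    and D: "orientation_of D G"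
  obtains M where "matched_bicyclic (pverts D) (parcs D) M n m"
proof -
  have pg: "pair_graph G" and con: "Digraph_Component.connected (with_proj G)"
    and ce: "card (edges G) = n + 1"
    using assms(3,4) by (auto simp: bicyclic_def)
  interpret pair_graph G by (rule pg)
  let ?e = "\<lambda>e. {fst e, snd e}"
  have bij: "bij_betw ?e (parcs D) (edges G)"
    by (rule bij_betw_orientation_edges[OF D pg])
  have verts: "pverts D = pverts G" and sub: "parcs D \<subseteq> parcs G"
    and anti: "\<And>u v. (u, v) \<in> parcs G \<Longrightarrow> (u, v) \<in> parcs D \<longleftrightarrow> (v, u) \<notin> parcs D"
    using D by (auto simp: orientation_of_def)
  have "finite (parcs D)" using sub pair_finite_arcs finite_subset by blast
  have "finite (edges G)" using ce by (intro card_ge_0_finite) simp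
  then obtain M0 where M0: "is_matching G M0" "card M0 = m"
    using obtain_maximum_matching assms(5) by metis
  define M where "M = {e\<in>parcs D. ?e e \<in> M0}"
  have M_img: "?e ` M = M0"
  proof
    show "?e ` M \<subseteq> M0" by (auto simp: M_def)
    show "M0 \<subseteq> ?e ` M"
    proof
      fix x assume x: "x \<in> M0"
      then have "x \<in> ?e ` parcs D"
        using M0(1) bij_betw_imp_surj_on[OF bij] by (auto simp: is_matching_def)
      then show "x \<in> ?e ` M" using x by (auto simp: M_def)
    qed
  qed
  have injM: "inj_on ?e M"
    using bij_betw_imp_inj_on[OF bij] by (rule inj_on_subset) (auto simp: M_def)
  have "matched_bicyclic (pverts D) (parcs D) M n m"
  proof
    show "finite (pverts D)" using verts pair_finite_verts by simp
    show "parcs D \<subseteq> pverts D \<times> pverts D"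
      using sub verts by (auto dest: in_arcsD1 in_arcsD2)
    show "(v, u) \<notin> parcs D" if "(u, v) \<in> parcs D" for u v
      using anti[of u v] sub that by blast
    show "card (parcs D) = n + 1" using bij_betw_same_card[OF bij] ce by simp
    show "M \<subseteq> parcs D" by (auto simp: M_def)
    show "card M = m" using card_image[OF injM] M_img M0(2) by simp
    show "vertex_disjoint M"
      unfolding vertex_disjoint_def
    proof (intro ballI impI)
      fix e g assume eg: "e \<in> M" "g \<in> M" "e \<noteq> g"
      then have "?e e \<in> M0" "?e g \<in> M0" by (auto simp: M_def)
      moreover have "?e e \<noteq> ?e g" using inj_onD[OF injM] eg by blast
      ultimately show "?e e \<inter> ?e g = {}"
        using M0(1) pairwiseD[of disjnt M0] unfolding is_matching_def disjnt_def by simp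
    qed
    show "1 \<le> outdeg (parcs D) v + indeg (parcs D) v" if v: "v \<in> pverts D" for v
    proof -
      obtain w where "(v, w) \<in> parcs G \<or> (w, v) \<in> parcs G"
        using connected_has_neighbour[OF con] v verts assms(1,2,4) by auto
      then have "(v, w) \<in> parcs D \<or> (w, v) \<in> parcs D" using anti by blast
      then have "(v, w) \<in> {e\<in>parcs D. fst e = v} \<or> (w, v) \<in> {e\<in>parcs D. snd e = v}" by simp
      then have "outdeg (parcs D) v \<noteq> 0 \<or> indeg (parcs D) v \<noteq> 0"
        unfolding outdeg_def indeg_def using \<open>finite (parcs D)\<close> by auto
      then show ?thesis by linarith
    qed
  qed (use verts assms(1,2,4) in simp_all)
  then show thesis using that by blast
qed

theorem theorem2:
  fixes n m :: nat and G D :: "'a pair_pre_digraph"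
  assumes "3 \<le> m" and "m \<le> n div 2"
    and "bicyclic G" and "card (pverts G) = n" and "matching_number G = m"
    and "orientation_of D G"
  shows "zagreb1 (with_proj D) \<le>
      1 / 2 * ((real m)\<^sup>2 - real m * (1 + 2 * real n) + (real n)\<^sup>2 + 5 * real n + 2)
    \<and> (zagreb1 (with_proj D) =
      1 / 2 * ((real m)\<^sup>2 - real m * (1 + 2 * real n) + (real n)\<^sup>2 + 5 * real n + 2)
      \<longleftrightarrow> digraph_iso (with_proj D) (with_proj (B1 n m))
        \<or> digraph_iso (with_proj D) (with_proj (B2 n m)))"
proof -
  have n: "2 * m \<le> n" using assms(2) by simp
  obtain M where "matched_bicyclic (pverts D) (parcs D) M n m"
    by (rule matched_bicyclic_orientation[OF assms(1) n assms(3-6)])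
  then interpret matched_bicyclic "pverts D" "parcs D" M n m .
  interpret rev: matched_bicyclic "pverts D" "(parcs D)\<inverse>" "M\<inverse>" n m
    by (rule matched_bicyclic_converse)
  have B1: "pverts (B1 n m) = {..<n}" by (simp add: B1_def)
  have B2: "pverts (B2 n m) = {..<n}" "parcs (B2 n m) = (parcs (B1 n m))\<inverse>"
    by (simp_all add: B2_def reverse_digraph_def B1)
  \<comment> \<open>Mapping onto the reversed \<open>B1\<close> is the same as mapping the reversed
    digraph onto \<open>B1\<close>, where \<open>rev\<close> applies.\<close>
  have flip: "map_prod f f ` A = B\<inverse> \<longleftrightarrow> map_prod f f ` (A\<inverse>) = B"
    for f :: "'a \<Rightarrow> nat" and A B
  proof -
    have "map_prod f f ` (A\<inverse>) = (map_prod f f ` A)\<inverse>" by force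
    then show ?thesis by (metis converse_converse)
  qed
  have "digraph_iso (with_proj D) (with_proj (B1 n m)) \<longleftrightarrow>
      (\<exists>c. dominating_source (parcs D) (n - m + 2) c)"
    unfolding digraph_iso_with_proj_iff[OF arcs_sub] dominating_source_iff_B1 B1 ..
  moreover have "digraph_iso (with_proj D) (with_proj (B2 n m)) \<longleftrightarrow>
      (\<exists>c. dominating_source ((parcs D)\<inverse>) (n - m + 2) c)"
    unfolding digraph_iso_with_proj_iff[OF arcs_sub] rev.dominating_source_iff_B1 B2 flip ..
  ultimately have "zsum (parcs D) = zbound n m \<longleftrightarrow>
      digraph_iso (with_proj D) (with_proj (B1 n m)) \<or> digraph_iso (with_proj D) (with_proj (B2 n m))"
    using zsum_eq_zbound_iff by blast
  then show ?thesis
    unfolding zagreb1_with_proj real_zbound[OF assms(1) n, symmetric] using zsum_le_zbound by simp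
qed

end
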